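(* Let $q$ be an odd prime power, let $t\geq 3$ be an integer and $n=2t$. For each $h\in \mathbb{F}_{q^n}\setminus \mathbb{F}_{q^t}$ such that $h^{q^t+1}=-1$, the $\mathbb{F}_q$-linearized polynomial \[\psi_{h,t}(x)= x^{q}+x^{q^{t-1}}-h^{1-q^{t+1}}x^{q^{t+1}}+h^{1-q^{2t-1}}x^{q^{2t-1}} \in \mathbb{F}_{q^{n}}[x]\] is scattered over $\mathbb{F}_{q^n}$.
   Context: A $q$-polynomial over $\mathbb{F}_{q^n}$ is a polynomial $f(x)=\sum_{i=0}^{n-1}c_ix^{q^i}$ with $c_i\in\mathbb{F}_{q^n}$, viewed as an $\mathbb{F}_q$-linear map of $\mathbb{F}_{q^n}$. Such an $f$ is called scattered (over $\mathbb{F}_{q^n}$) if for all $x\in\mathbb{F}_{q^n}^*$ and $\gamma\in\mathbb{F}_{q^n}$, the equality $f(\gamma x)=\gamma f(x)$ implies $\gamma\in\mathbb{F}_q$; equivalently, for $z,y\in\mathbb{F}_{q^n}^*$, $f(z)/z=f(y)/y$ implies that $z,y$ are $\mathbb{F}_q$-linearly dependent. Negative exponents such as $h^{1-q^{t+1}}$ make sense since $h\neq 0$. *)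

theory Defs
  imports
    "HOL-Number_Theory.Prime_Powers"
    "HOL-Algebra.Algebraic_Closure_Type"
    "HOL-Library.Cardinality"
begin

text \<open>
  The field of order \<open>q ^ n\<close> is a type \<open>'a\<close> of class \<open>{field, finite}\<close> with \<open>CARD('a) = q ^ n\<close>.
  Its subfields are subsets \<open>K\<close> with \<open>subfield K ring_of_type_algebra\<close>, where
  \<open>ring_of_type_algebra\<close> is the type \<open>'a\<close> seen as a ring record with carrier \<open>UNIV\<close>.
\<close>

definition q_polynomial :: "nat \<Rightarrow> nat \<Rightarrow> 'a::field poly \<Rightarrow> bool" where
  "q_polynomial q n f \<longleftrightarrow> (\<exists>c. f = (\<Sum>i<n. Polynomial.monom (c i) (q ^ i)))"

definition scattered :: "'a set \<Rightarrow> 'a::field poly \<Rightarrow> bool" where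
  "scattered Fq f \<longleftrightarrow>
     (\<forall>x \<gamma>. x \<noteq> 0 \<longrightarrow> poly f (\<gamma> * x) = \<gamma> * poly f x \<longrightarrow> \<gamma> \<in> Fq)"

text \<open>The exponents of \<open>h\<close> are negative integers, hence \<open>powi\<close>.\<close>

definition psi :: "nat \<Rightarrow> nat \<Rightarrow> 'a::field \<Rightarrow> 'a poly" where
  "psi q t h =
     Polynomial.monom 1 (q ^ 1)
     + Polynomial.monom 1 (q ^ (t - 1))
     - Polynomial.monom (h powi (1 - int (q ^ (t + 1)))) (q ^ (t + 1))
     + Polynomial.monom (h powi (1 - int (q ^ (2 * t - 1)))) (q ^ (2 * t - 1))"

end

theory Submission
  imports Defs "HOL-Number_Theory.Residues"
begin

text \<open>
  Write \<open>s x = x ^ q\<close>, \<open>bar = s ^^ t\<close>, \<open>h = s (s k)\<close> and \<open>D = 1 - k * s (s k)\<close>. Since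
  \<open>bar h = - 1 / h\<close>, the map \<open>psi\<close> is the sum of two maps that are semilinear over the fixed field
  of \<open>bar\<close>, each with a one-dimensional kernel. These kernels are complementary, so that
  \<open>x = s z + b\<close> with \<open>z\<close> and \<open>b\<close> on two fixed lines, and
  \<open>psi x = - z * D / (k * s k) + s b * s (s D)\<close>.

  Let \<open>y = \<gamma> * x = s z' + b'\<close> with \<open>psi y = \<gamma> * psi x\<close>. Comparing \<open>y * psi x = x * psi y\<close> with its
  image under \<open>bar\<close> determines \<open>s V / V\<close> for \<open>V = z' * b - z * b'\<close>, if \<open>V \<noteq> 0\<close>. This makes \<open>V\<close> a
  fixed point \<open>c\<close> of \<open>s\<close> times an explicit element, for which \<open>bar\<close> gives \<open>bar c = - c\<close>, although
  \<open>bar\<close> is a power of \<open>s\<close>. Hence \<open>V = 0\<close>, and the rest of the equation yields either \<open>s \<gamma> = \<gamma>\<close> or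
  some \<open>p\<close> with \<open>p * s p = - 1\<close> and \<open>bar p = - p\<close>, which cannot exist in odd characteristic.
\<close>

section \<open>Twisted field automorphisms of even order\<close>

locale field_automorphism =
  fixes s :: "'a::field \<Rightarrow> 'a"
  assumes add: "s (x + y) = s x + s y"
    and mult: "s (x * y) = s x * s y"
    and one: "s 1 = 1"
begin

lemma zero: "s 0 = 0"
  using add[of 0 0] by (metis add.right_neutral add_left_imp_eq)

lemma uminus: "s (- x) = - s x"
  using add[of x "- x"] zero by (simp add: eq_neg_iff_add_eq_0 add.commute)

lemma diff: "s (x - y) = s x - s y"
  using add[of x "- y"] uminus[of y] by simp

lemma eq_0_iff: "s x = 0 \<longleftrightarrow> x = 0"
proof
  show "x = 0" if "s x = 0"
  proof (rule ccontr)
    assume "x \<noteq> 0"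
    then have "s x * s (inverse x) = 1"
      by (simp flip: mult add: one)
    with that show False by simp
  qed
qed (simp add: zero)

lemma inverse: "s (inverse x) = inverse (s x)"
proof (cases "x = 0")
  case False
  then have "s x * s (inverse x) = 1"
    by (simp flip: mult add: one)
  then show ?thesis
    by (simp add: inverse_unique)
qed (simp add: zero)

lemma divide: "s (x / y) = s x / s y"
  by (simp add: divide_inverse mult inverse)

lemma eq_iff: "s x = s y \<longleftrightarrow> x = y"
  using eq_0_iff[of "x - y"] by (simp add: diff)

lemmas hom = add mult one zero uminus diff inverse divide

lemma funpow: "field_automorphism (s ^^ i)"
  by (induction i) (simp_all add: field_automorphism_def hom)

end

text \<open>Models \<open>x ^ q\<close> on a field of order \<open>q ^ (2 * t)\<close>,
  \<open>q\<close> odd. \<open>norm_k\<close> and \<open>k_not_fixed\<close> are the hypotheses on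
  \<open>h\<close>, pulled back along \<open>s\<close> twice.\<close>

locale twisted_automorphism = field_automorphism s for s :: "'a::field \<Rightarrow> 'a" +
  fixes t :: nat and k :: 'a and bar :: "'a \<Rightarrow> 'a"
  defines "bar \<equiv> s ^^ t"
  assumes t_pos: "t > 0"
    and two: "(2 :: 'a) \<noteq> 0"
    and bar_bar: "bar (bar x) = x"
    and norm_k: "k * bar k = - 1"
    and k_not_fixed: "bar k \<noteq> k"
begin

sublocale bar: field_automorphism bar
  unfolding bar_def by (rule funpow)

lemma s_bar: "bar (s x) = s (bar x)"
  by (simp add: bar_def funpow_swap1)

lemma neq_neg:
  fixes x :: 'a
  assumes "x \<noteq> 0"
  shows "x \<noteq> - x"
proof
  assume "x = - x"
  then have "2 * x = 0"
    unfolding mult_2 by (simp only: eq_neg_iff_add_eq_0)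
  with assms two show False by simp
qed

lemma k_nz: "k \<noteq> 0"
  using norm_k by force

lemma bar_k: "bar k = - 1 / k"
  using norm_k k_nz by (simp add: field_simps)

section \<open>The orbit of \<open>k\<close>, and elements with short orbits under
  \<open>s\<close>\<close>

abbreviation "k1 \<equiv> s k"
abbreviation "k2 \<equiv> s k1"
abbreviation "k3 \<equiv> s k2"
abbreviation "k4 \<equiv> s k3"

definition "D = 1 - k * k2"

text \<open>If \<open>s ^^ 4\<close> fixes \<open>x\<close>, then \<open>s ^^ t\<close> acts on
  \<open>x\<close> as \<open>s ^^ (t mod 4)\<close>.\<close>

lemma bar_period:
  assumes "s (s (s (s x))) = x"
  shows "bar x = x \<or> bar x = s x \<or> bar x = s (s x) \<or> bar x = s (s (s x))"
proof -
  have "(s ^^ 4) x = x"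
    using assms by (simp add: eval_nat_numeral)
  then have "((s ^^ 4) ^^ j) x = x" for j
    by (induction j) simp_all
  then have "(s ^^ (4 * (t div 4))) x = x"
    by (metis funpow_mult mult.commute)
  then have "(s ^^ (t mod 4 + 4 * (t div 4))) x = (s ^^ (t mod 4)) x"
    unfolding funpow_add by simp
  then have bar: "bar x = (s ^^ (t mod 4)) x"
    by (simp add: bar_def)
  define i where "i = t mod 4"
  then have "i < 4" by simp
  then have "i = 0 \<or> i = 1 \<or> i = 2 \<or> i = 3"
    by linarith
  then show ?thesis
    unfolding bar i_def[symmetric] by (elim disjE) (simp_all add: eval_nat_numeral)
qed

text \<open>If \<open>k * k2 = 1\<close>, then \<open>k4 = k\<close>, so \<open>bar k\<close> is one
  of four conjugates. Each choice contradicts \<open>bar k = - 1 / k\<close>,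
  \<open>k_not_fixed\<close> or \<open>two\<close>.\<close>

lemma D_nz: "D \<noteq> 0"
proof
  assume "D = 0"
  then have k2: "k2 = 1 / k"
    using k_nz by (simp add: D_def field_simps)
  then have k3: "k3 = 1 / k1"
    by (simp add: hom)
  have "k4 = k"
    using k2 by (simp add: k3 hom)
  from bar_period[OF this] have cases:
    "bar k = k \<or> bar k = k1 \<or> bar k = k2 \<or> bar k = k3" .
  \<comment> \<open>Here \<open>k\<close> is \<open>1\<close> or \<open>- 1\<close>, hence fixed by
    \<open>s\<close>, while both alternatives amount to \<open>k1 = - k\<close>.\<close>
  have no_fix: False if "k * k = 1" "k1 = - 1 / k \<or> k1 = - k"
  proof -
    have "(k - 1) * (k + 1) = 0"
      using that(1) by (simp add: algebra_simps)
    then have "k = 1 \<or> k = - 1"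
      by (simp add: eq_neg_iff_add_eq_0)
    then have "k1 = k" by (auto simp: hom)
    moreover have "- 1 / k = - k"
      using that(1) k_nz by (simp add: field_simps)
    ultimately show False
      using that(2) neq_neg[OF k_nz] by metis
  qed
  from cases show False
  proof (elim disjE)
    assume "bar k = k"
    with k_not_fixed show ?thesis by simp
  next
    assume "bar k = k1"
    then have k1: "k1 = - 1 / k" by (simp add: bar_k)
    then have "k2 = - 1 / k1" by (metis divide one uminus)
    also have "\<dots> = k" by (simp add: k1)
    finally have "k2 = k" .
    with k2 have "k * k = 1" using k_nz by (simp add: field_simps)
    with no_fix k1 show ?thesis by blast
  next
    assume "bar k = k2"
    then have "k2 = - 1 / k" by (simp add: bar_k)
    with k2 have "1 / k = - (1 / k)" by simp
    then show ?thesis using neq_neg[of "1 / k"] k_nz by simp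
  next
    assume "bar k = k3"
    then have "k3 = - 1 / k" by (simp add: bar_k)
    with k3 k_nz have "- k1 = k"
      using eq_0_iff[of k] by (simp add: field_simps)
    then have k1: "k1 = - k" by (metis minus_minus)
    then have "k2 = k" by (simp add: hom)
    with k2 have "k * k = 1" using k_nz by (simp add: field_simps)
    with no_fix k1 show ?thesis by blast
  qed
qed

text \<open>\<open>s\<close> exchanges \<open>p\<close> and \<open>- 1 / p\<close>, so
  \<open>bar p\<close> is \<open>p\<close> or \<open>s p\<close>. The sign leaves
  \<open>s p = - p\<close>; then \<open>p * p = 1\<close>, which makes \<open>p\<close> a fixed
  point of \<open>s\<close>.\<close>

lemma no_twisted_norm:
  assumes "p * s p = - 1" and "bar p = - p"
  shows False
proof -
  have p_nz: "p \<noteq> 0" using assms(1) by force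
  have sp: "s p = - 1 / p"
    using assms(1) p_nz by (simp add: field_simps)
  then have ssp: "s (s p) = p"
    by (simp add: hom)
  then have "bar p = p \<or> bar p = s p"
    using bar_period[of p] by auto
  then have "s p = - p"
  proof
    assume "bar p = p"
    from trans[OF this[symmetric] assms(2)] show ?thesis
      using neq_neg[OF p_nz] by contradiction
  next
    assume "bar p = s p"
    from trans[OF this[symmetric] assms(2)] show ?thesis .
  qed
  with assms(1) have "(p - 1) * (p + 1) = 0"
    by (simp add: algebra_simps)
  then have "p = 1 \<or> p = - 1"
    by (simp add: eq_neg_iff_add_eq_0)
  then have "s p = p" by (auto simp: hom)
  from trans[OF this[symmetric] \<open>s p = - p\<close>] show False
    using neq_neg[OF p_nz] by contradiction
qed

text \<open>
  With \<open>h = k2\<close>, the lines \<open>s ` Zline\<close> and \<open>Bline\<close> are the kernels of the two halves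
  \<open>s x - h / s (bar h) * s (bar x)\<close> and \<open>tau x + h / tau (bar h) * tau (bar x)\<close> of \<open>twisted_psi\<close>
  below, where \<open>s (tau x) = bar x\<close>. Working with \<open>k\<close> and \<open>z\<close> instead of \<open>h\<close> and \<open>s z\<close> avoids
  negative powers of \<open>s\<close>.
\<close>

definition "Zline = {z. bar z = - z / (k * k1)}"
definition "Bline = {b. bar b = - b * k3 / k2}"

section \<open>Action of \<open>bar\<close> on the orbits of \<open>k\<close> and \<open>D\<close>
  and on the two lines\<close>

lemma k_simps: "k \<noteq> 0" "k1 \<noteq> 0" "k2 \<noteq> 0" "k3 \<noteq> 0" "k4 \<noteq> 0"
  by (simp_all add: eq_0_iff k_nz)

lemma D_simps: "D \<noteq> 0" "s D \<noteq> 0" "s (s D) \<noteq> 0"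
  by (simp_all add: eq_0_iff D_nz)

lemma bar_k_simps: "bar k = - 1 / k" "bar k1 = - 1 / k1" "bar k2 = - 1 / k2"
    "bar k3 = - 1 / k3" "bar k4 = - 1 / k4"
  by (simp_all add: s_bar bar_k hom)

lemma bar_D_simps: "bar D = - D / (k * k2)" "bar (s D) = - s D / (k1 * k3)"
    "bar (s (s D)) = - s (s D) / (k2 * k4)"
proof -
  show "bar D = - D / (k * k2)"
    using k_simps by (simp add: D_def bar.hom bar_k_simps field_simps)
  then show "bar (s D) = - s D / (k1 * k3)"
    by (simp add: s_bar hom)
  then show "bar (s (s D)) = - s (s D) / (k2 * k4)"
    by (simp add: s_bar hom)
qed

lemma bar_Z: "z \<in> Zline \<Longrightarrow> bar z = - z / (k * k1)"
    "z \<in> Zline \<Longrightarrow> bar (s z) = - s z / (k1 * k2)"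
  by (simp_all add: Zline_def s_bar hom)

lemma bar_B: "b \<in> Bline \<Longrightarrow> bar b = - b * k3 / k2"
    "b \<in> Bline \<Longrightarrow> bar (s b) = - s b * k4 / k3"
  by (simp_all add: Bline_def s_bar hom)

definition "tau = s ^^ (t - 1)"

sublocale tau: field_automorphism tau
  unfolding tau_def by (rule funpow)

lemma s_tau: "s (tau x) = bar x"
  using t_pos unfolding bar_def tau_def by (metis One_nat_def Suc_pred comp_apply funpow.simps(2))

lemma tau_s: "tau (s x) = bar x"
  using s_tau unfolding tau_def by (metis funpow_swap1)

lemma surj: "\<exists>y. x = s y"
proof -
  have "x = s (tau (bar x))"
    by (simp add: s_tau bar_bar)
  then show ?thesis by blast
qed

lemma decompose:
  obtains z b where "z \<in> Zline" "b \<in> Bline" "x = s z + b"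
proof -
  \<comment> \<open>\<open>u\<close> and \<open>v\<close> are the multipliers of \<open>bar\<close>
    on the two lines; they differ because \<open>s D\<close> is nonzero.\<close>
  define u where "u = - 1 / (k1 * k2)"
  define v where "v = - k3 / k2"
  have "u - v = - (1 - k1 * k3) / (k1 * k2)"
    unfolding u_def v_def using k_simps by (simp add: divide_simps)
  then have "u - v = - s D / (k1 * k2)"
    by (simp add: D_def hom)
  then have uv: "u - v \<noteq> 0" "u \<noteq> 0" "v \<noteq> 0"
    using k_simps D_simps by (simp_all add: u_def v_def)
  have bu: "bar u = 1 / u" and bv: "bar v = 1 / v"
    using k_simps by (simp_all add: u_def v_def bar.hom bar_k_simps)
  \<comment> \<open>Solution of \<open>x = a + b\<close> and
    \<open>bar x = u * a + v * b\<close>.\<close>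
  define a where "a = (bar x - v * x) / (u - v)"
  define b where "b = (u * x - bar x) / (u - v)"
  have den: "1 / u - 1 / v = - (u - v) / (u * v)"
    using uv by (simp add: field_simps)
  have "bar a = (x - bar x / v) / (- (u - v) / (u * v))"
    by (simp add: a_def bar.hom bu bv bar_bar den)
  also have "\<dots> = u * a"
    using uv unfolding a_def by (simp add: divide_simps) (simp add: algebra_simps)
  finally have a: "bar a = u * a" .
  have "bar b = (bar x / u - x) / (- (u - v) / (u * v))"
    by (simp add: b_def bar.hom bu bv bar_bar den)
  also have "\<dots> = v * b"
    using uv unfolding b_def by (simp add: divide_simps) (simp add: algebra_simps)
  finally have b: "bar b = v * b" .
  obtain z where z: "a = s z" using surj by blast
  have "s (bar z) = s (- z / (k * k1))"
    using a by (simp add: z u_def hom flip: s_bar)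
  then have "z \<in> Zline"
    by (simp add: Zline_def eq_iff)
  moreover have "b \<in> Bline"
    using b by (simp add: Bline_def v_def)
  moreover have "x = a + b"
    using uv(1) by (simp add: a_def b_def flip: add_divide_distrib) (simp add: field_simps)
  ultimately show ?thesis using that z by blast
qed

text \<open>The map of \<open>psi\<close> for \<open>h = k2\<close>, with the powers of
  \<open>h\<close> written as quotients.\<close>

definition twisted_psi :: "'a \<Rightarrow> 'a" where
  "twisted_psi x = s x + tau x - k2 / s (bar k2) * s (bar x) + k2 / tau (bar k2) * tau (bar x)"

lemma twisted_psi_eq:
  assumes "z \<in> Zline" "b \<in> Bline"
  shows "twisted_psi (s z + b) = - z * D / (k * k1) + s b * s (s D)"
proof -
  \<comment> \<open>The second half of \<open>twisted_psi\<close> at \<open>b\<close> is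
    \<open>c + k2 / k1 * bar c\<close>; that it vanishes is checked after applying the injective
    \<open>s\<close>.\<close>
  define c where "c = tau b"
  have sc: "s c = bar b" unfolding c_def by (rule s_tau)
  have "s (c + k2 / k1 * bar c) = bar b + k3 / k2 * s (bar c)"
    by (simp add: hom sc)
  also have "s (bar c) = b"
    by (simp add: sc bar_bar flip: s_bar)
  also have "bar b + k3 / k2 * b = 0"
    using bar_B(1)[OF assms(2)] by simp
  finally have c: "c + k2 / k1 * bar c = 0"
    by (simp add: eq_0_iff)
  have bc: "tau (bar b) = bar c"
    unfolding sc[symmetric] by (rule tau_s)
  \<comment> \<open>The brackets are the first half at \<open>s z\<close> and \<open>b\<close>, then
    the second half at \<open>s z\<close> and \<open>b\<close>; the outer two vanish.\<close>
  have "twisted_psi (s z + b) =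
      (s (s z) + k2 * k3 * s (bar (s z))) + (s b + k2 * k3 * s (bar b))
      + (bar z + k2 / k1 * z) + (c + k2 / k1 * bar c)"
    by (simp add: twisted_psi_def hom bar.hom tau.hom s_bar bar_k_simps tau_s bc bar_bar
        flip: c_def) (simp add: algebra_simps add_divide_distrib)
  also have "bar z + k2 / k1 * z = - z * D / (k * k1)"
    using k_simps by (simp add: bar_Z[OF assms(1)] D_def field_simps)
  also have "s (s z) + k2 * k3 * s (bar (s z)) = 0"
    using k_simps by (simp add: bar_Z[OF assms(1)] hom)
  also have "s b + k2 * k3 * s (bar b) = s b * s (s D)"
    using k_simps by (simp add: bar_B[OF assms(2)] D_def hom field_simps)
  finally show ?thesis unfolding c by simp
qed

text \<open>Makes the coordinates of the two arguments proportional, so that a single multiplier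
  describes both.\<close>

lemma cross_term_zero:
  assumes "z \<in> Zline" "b \<in> Bline" "z' \<in> Zline" "b' \<in> Bline"
    and eq: "(s z' + b') * twisted_psi (s z + b) = (s z + b) * twisted_psi (s z' + b')"
  shows "z' * b = z * b'"
proof (rule ccontr)
  note bars = bar_Z[OF assms(1)] bar_Z[OF assms(3)] bar_B[OF assms(2)] bar_B[OF assms(4)]
  note nz = k_simps D_simps
  define V where "V = z' * b - z * b'"
  assume "z' * b \<noteq> z * b'"
  then have V_nz: "V \<noteq> 0" by (simp add: V_def)
  \<comment> \<open>\<open>bar\<close> acts by a different scalar on each of the three summands.\<close>
  define E1 where "E1 = - D / (k * k1) * (z * s z' - z' * s z) + s (s D) * (b' * s b - b * s b')"
  define E2 where "E2 = s (s D) * s V"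
  define E3 where "E3 = D / (k * k1) * V"
  have bar_V: "bar V = V * k3 / (k * k1 * k2)"
    using nz by (simp add: V_def bar.hom bars field_simps)
  then have bar_sV: "bar (s V) = s V * k4 / (k1 * k2 * k3)"
    by (simp add: s_bar hom)
  have sum: "E1 + E2 + E3 = 0"
    using eq unfolding twisted_psi_eq[OF assms(1,2)] twisted_psi_eq[OF assms(3,4)]
    by (simp add: E1_def E2_def E3_def V_def hom algebra_simps diff_divide_distrib add_divide_distrib)
  have "bar E1 = - E1 / (k2 * k2)"
    using nz by (simp add: E1_def bar.hom bars bar_k_simps bar_D_simps) (simp add: field_simps)
  moreover have "bar E2 = - E2 / (k1 * k2 * k2 * k3)"
    using nz by (simp add: E2_def bar.hom bar_sV bar_D_simps field_simps)
  moreover have "bar E3 = - E3 * k1 * k3 / (k2 * k2)"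
    using nz by (simp add: E3_def bar.hom bar_V bar_k_simps bar_D_simps field_simps)
  ultimately have "- (E1 + E2 / (k1 * k3) + k1 * k3 * E3) / (k2 * k2) = bar (E1 + E2 + E3)"
    using nz by (simp only: bar.add) (simp add: field_simps)
  also have "\<dots> = 0"
    by (simp only: sum bar.zero)
  finally have "E1 + E2 / (k1 * k3) + k1 * k3 * E3 = 0"
    using nz by (simp only: divide_eq_0_iff mult_eq_0_iff neg_equal_0_iff_equal) simp
  \<comment> \<open>Eliminates \<open>E1\<close> between the relation and its image under
    \<open>bar\<close>.\<close>
  moreover have "(1 - k1 * k3) * (E2 - k1 * k3 * E3) =
      k1 * k3 * (E1 + E2 / (k1 * k3) + k1 * k3 * E3) - k1 * k3 * (E1 + E2 + E3)"
    using nz by (simp add: field_simps)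
  ultimately have "(1 - k1 * k3) * (E2 - k1 * k3 * E3) = 0"
    by (simp only: sum mult_zero_right diff_self)
  moreover have "1 - k1 * k3 = s D" by (simp add: D_def hom)
  ultimately have "E2 = k1 * k3 * E3"
    using nz by simp
  then have key: "s (s D) * s V = k3 / k * D * V"
    using nz by (simp add: E2_def E3_def field_simps)
  \<comment> \<open>\<open>Y\<close> and \<open>Z\<close> both solve
    \<open>s X = k3 / k * X\<close>, so \<open>s\<close> fixes their quotient.\<close>
  define Y where "Y = V * D * s D"
  define Z where "Z = k * k1 * k2"
  have Z_nz: "Z \<noteq> 0" and Y_nz: "Y \<noteq> 0" using nz V_nz by (simp_all add: Z_def Y_def)
  have sY: "s Y = k3 / k * Y"
    using key by (simp add: Y_def hom) (metis (no_types, lifting) mult.assoc mult.commute times_divide_eq_left)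
  have sZ: "s Z = k3 / k * Z"
    using nz by (simp add: Z_def hom)
  have "s (Y / Z) = Y / Z"
    using nz Z_nz by (simp add: hom sY sZ)
  then have "(s ^^ i) (Y / Z) = Y / Z" for i
    by (induction i) simp_all
  then have "bar (Y / Z) = Y / Z"
    by (simp add: bar_def)
  \<comment> \<open>The signs of \<open>D\<close> and \<open>s D\<close> cancel in \<open>Y\<close>,
    whereas the three factors of \<open>Z\<close> leave one sign.\<close>
  moreover have "bar Y = Y / (Z * Z)" "bar Z = - Z / (Z * Z)"
    using nz by (simp_all add: Y_def Z_def bar.hom bar_V bar_D_simps bar_k_simps field_simps)
  then have "bar (Y / Z) = - (Y / Z)"
    using Z_nz by (simp add: bar.hom)
  ultimately show False
    using neq_neg[of "Y / Z"] Y_nz Z_nz by simp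
qed

lemma twisted_psi_scattered:
  assumes "x \<noteq> 0" and eq: "twisted_psi (\<gamma> * x) = \<gamma> * twisted_psi x"
  shows "s \<gamma> = \<gamma>"
proof -
  note nz = k_simps D_simps
  obtain z b where zb: "z \<in> Zline" "b \<in> Bline" and x: "x = s z + b"
    using decompose by blast
  obtain z' b' where zb': "z' \<in> Zline" "b' \<in> Bline" and y: "\<gamma> * x = s z' + b'"
    using decompose by blast
  have main: "(s z' + b') * twisted_psi (s z + b) = (s z + b) * twisted_psi (s z' + b')"
    using eq unfolding y[symmetric] x[symmetric] by simp
  have cross: "z' * b = z * b'"
    using cross_term_zero[OF zb zb' main] .
  then have "s (z' * b) = s (z * b')" by simp
  then have s_cross: "s z' * s b = s z * s b'" by (simp add: hom)
  \<comment> \<open>What remains of \<open>main\<close> once the cross terms drop out.\<close>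
  have "D / (k * k1) * (z * s z' - z' * s z) - s (s D) * (b' * s b - b * s b')
      = D / (k * k1) * (z' * b - z * b') + s (s D) * (s z' * s b - s z * s b')
        - ((s z' + b') * twisted_psi (s z + b) - (s z + b) * twisted_psi (s z' + b'))"
    unfolding twisted_psi_eq[OF zb] twisted_psi_eq[OF zb']
    by (simp add: algebra_simps diff_divide_distrib add_divide_distrib)
  also have "\<dots> = 0"
    by (simp only: main cross s_cross diff_self mult_zero_right add_0_right)
  finally have diag: "D / (k * k1) * (z * s z' - z' * s z) = s (s D) * (b' * s b - b * s b')"
    by (simp only: right_minus_eq)
  show ?thesis
  proof (cases "z = 0")
    case True
    with x \<open>x \<noteq> 0\<close> have b_nz: "b \<noteq> 0" by (simp add: hom)
    with cross True have "z' = 0" by simp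
    with True y x have "\<gamma> * b = b'" by (simp add: hom)
    then have "b' * s b - b * s b' = b * s b * (\<gamma> - s \<gamma>)"
      by (auto simp: hom algebra_simps)
    with diag True \<open>z' = 0\<close> nz b_nz show ?thesis by (simp add: hom eq_0_iff)
  next
    case False
    define m where "m = z' / z"
    have z': "z' = m * z" using False by (simp add: m_def)
    with cross False have b': "b' = m * b" by simp
    \<comment> \<open>With \<open>z' = m * z\<close> and \<open>b' = m * b\<close>, both sides of
      \<open>diag\<close> contain the factor \<open>s m - m\<close>.\<close>
    have "D / (k * k1) * (z * s z) * (s m - m) = - s (s D) * (b * s b) * (s m - m)"
      using diag by (simp add: z' b' hom algebra_simps diff_divide_distrib)
    then consider "s m = m" | "D / (k * k1) * (z * s z) = - s (s D) * (b * s b)"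
      unfolding mult_cancel_right right_minus_eq by blast
    then show ?thesis
    proof cases
      case 1
      then have "\<gamma> * x = m * x" using y by (simp add: z' b' x hom algebra_simps)
      with \<open>x \<noteq> 0\<close> 1 show ?thesis by simp
    next
      case 2
      \<comment> \<open>Chosen so that the second alternative reads
        \<open>p * s p = - 1\<close>.\<close>
      define p where "p = b * s D * k / (z * D)"
      have "s z \<noteq> 0" using False by (simp add: eq_0_iff)
      then have "b * s b * s (s D) * k * k1 = - (D * (z * s z))"
        using 2 nz by (simp add: field_simps)
      then have "p * s p = - 1"
        using nz False \<open>s z \<noteq> 0\<close> by (simp add: p_def hom divide_simps) (simp add: algebra_simps)
      moreover have "bar p = - p"
        using nz False
        by (simp add: p_def bar.hom bar_D_simps bar_k_simps bar_Z[OF zb(1)] bar_B[OF zb(2)])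
      ultimately show ?thesis using no_twisted_norm by blast
    qed
  qed
qed

end

section \<open>Finite fields\<close>

text \<open>Multiplication by a nonzero \<open>x\<close> permutes the nonzero elements of
  \<open>K\<close>. Serves both for subfields and for the whole field.\<close>

lemma power_card_eq_self:
  fixes K :: "'a::field set"
  assumes "finite K" "0 \<in> K" "\<And>x y. x \<in> K \<Longrightarrow> y \<in> K \<Longrightarrow> x * y \<in> K" "x \<in> K"
  shows "x ^ card K = x"
proof (cases "x = 0")
  case True
  with assms show ?thesis by (auto simp: card_gt_0_iff power_0_left)
next
  case False
  let ?K = "K - {0}"
  have fin: "finite ?K" using assms by simp
  have inj: "inj_on ((*) x) ?K" using False by (auto simp: inj_on_def)
  have "(*) x ` ?K = ?K"
    by (rule endo_inj_surj[OF fin _ inj]) (use assms(3,4) False in auto)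
  then have "\<Prod>?K = (\<Prod>y\<in>?K. x * y)"
    using prod.reindex[OF inj, of id] by simp
  also have "\<dots> = x ^ card ?K * \<Prod>?K"
    by (simp add: prod.distrib)
  finally have "x ^ card ?K = 1" using fin by simp
  moreover have "card K = Suc (card ?K)"
    using card.remove[OF assms(1,2)] .
  ultimately show ?thesis by simp
qed

text \<open>The polynomial \<open>X ^ N - X\<close> has at most \<open>N\<close> roots, and
  \<open>K\<close> already supplies \<open>N\<close>.\<close>

lemma subfield_eq_fixed_points:
  fixes K :: "'a::{field,finite} set"
  assumes "subfield K ring_of_type_algebra" and card: "card K = N" and "N > 1"
  shows "K = {x. x ^ N = x}"
proof -
  note sr = subringE[OF subfieldE(1)[OF assms(1)], unfolded ring_of_type_algebra_def, simplified]
  let ?P = "Polynomial.monom (1::'a) N - Polynomial.monom 1 1"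
  have "poly.coeff ?P N = 1"
    using \<open>N > 1\<close> by simp
  then have "?P \<noteq> 0" by (metis Polynomial.coeff_0 zero_neq_one)
  then have "card {x. poly ?P x = 0} \<le> degree ?P"
    by (rule card_poly_roots_bound)
  also have "\<dots> \<le> N"
    using \<open>N > 1\<close> by (intro degree_diff_le order.trans[OF degree_monom_le]) auto
  also have "{x. poly ?P x = 0} = {x::'a. x ^ N = x}"
    by (simp add: poly_monom)
  finally have "card {x::'a. x ^ N = x} \<le> card K"
    by (simp add: card)
  moreover have "K \<subseteq> {x. x ^ N = x}"
    using power_card_eq_self[of K] sr card by auto
  ultimately show ?thesis
    by (intro card_seteq) auto
qed

text \<open>Needed for the additivity of \<open>x ^ q\<close>.\<close>

lemma primepow_eq_CHAR_power:
  assumes "primepow q" "CARD('a::{field,finite}) = q ^ n"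
  obtains e where "q = CHAR('a) ^ e" "Factorial_Ring.prime CHAR('a)"
proof -
  obtain p e where pe: "Factorial_Ring.prime p" "q = p ^ e"
    using assms(1) by (auto simp: primepow_def)
  have "CHAR('a) > 0"
    by (rule finite_imp_CHAR_pos) simp
  then have "Factorial_Ring.prime CHAR('a)"
    by (rule prime_CHAR_semidom)
  moreover have "CHAR('a) dvd (p ^ e) ^ n"
    using CHAR_dvd_CARD[where ?'a = 'a] assms pe by simp
  then have "CHAR('a) = p"
    using \<open>Factorial_Ring.prime CHAR('a)\<close> pe(1) by (meson prime_dvd_power primes_dvd_imp_eq)
  ultimately show ?thesis using that pe by blast
qed

section \<open>Iterated powers and \<open>q\<close>-polynomials\<close>

lemma funpow_power: "((\<lambda>x::'a::monoid_mult. x ^ q) ^^ i) x = x ^ (q ^ i)"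
  by (induction i) (simp_all flip: power_mult add: mult.commute)

lemma q_polynomial_monom: "i < n \<Longrightarrow> q_polynomial q n (Polynomial.monom c (q ^ i))"
proof -
  assume "i < n"
  have "(\<Sum>j<n. Polynomial.monom (if j = i then c else 0) (q ^ j))
      = (\<Sum>j<n. if j = i then Polynomial.monom c (q ^ j) else 0)"
    by (intro sum.cong) auto
  also have "\<dots> = Polynomial.monom c (q ^ i)"
    using \<open>i < n\<close> by simp
  finally show ?thesis
    unfolding q_polynomial_def by metis
qed

lemma q_polynomial_add:
  assumes "q_polynomial q n f" "q_polynomial q n g"
  shows "q_polynomial q n (f + g)"
proof -
  obtain c d where "f = (\<Sum>i<n. Polynomial.monom (c i) (q ^ i))"
      and "g = (\<Sum>i<n. Polynomial.monom (d i) (q ^ i))"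
    using assms unfolding q_polynomial_def by blast
  then have "f + g = (\<Sum>i<n. Polynomial.monom (c i + d i) (q ^ i))"
    by (simp flip: add_monom sum.distrib)
  then show ?thesis
    unfolding q_polynomial_def by (rule exI[where x = "\<lambda>i. c i + d i"])
qed

lemma q_polynomial_diff:
  assumes "q_polynomial q n f" "q_polynomial q n g"
  shows "q_polynomial q n (f - g)"
proof -
  obtain c d where "f = (\<Sum>i<n. Polynomial.monom (c i) (q ^ i))"
      and "g = (\<Sum>i<n. Polynomial.monom (d i) (q ^ i))"
    using assms unfolding q_polynomial_def by blast
  then have "f - g = (\<Sum>i<n. Polynomial.monom (c i - d i) (q ^ i))"
    by (simp flip: diff_monom sum_subtractf)
  then show ?thesis
    unfolding q_polynomial_def by (rule exI[where x = "\<lambda>i. c i - d i"])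
qed

lemma q_polynomial_psi: "t \<ge> 2 \<Longrightarrow> q_polynomial q (2 * t) (psi q t h)"
  unfolding psi_def
  by (intro q_polynomial_add q_polynomial_diff q_polynomial_monom) auto

theorem theorem3p1:
  fixes q t n :: nat
    and Fq Fqt :: "'a::{field,finite} set"
    and h :: 'a
  assumes "primepow q" and "odd q"
    and "t \<ge> 3" and "n = 2 * t"
    and "CARD('a) = q ^ n"
    and "subfield Fq ring_of_type_algebra" and "card Fq = q"
    and "subfield Fqt ring_of_type_algebra" and "card Fqt = q ^ t"
    and "h \<notin> Fqt" and "h ^ (q ^ t + 1) = - 1"
  shows "q_polynomial q n (psi q t h) \<and> scattered Fq (psi q t h)"
proof
  show "q_polynomial q n (psi q t h)"
    using q_polynomial_psi[of t q h] assms(3,4) by simp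
  have q: "q > 1" using assms(1) by (rule primepow_gt_Suc_0[unfolded One_nat_def[symmetric]])
  obtain e where e: "q = CHAR('a) ^ e" "Factorial_Ring.prime CHAR('a)"
    using primepow_eq_CHAR_power[OF assms(1,5)] .
  define s where "s = (\<lambda>x::'a. x ^ q)"
  interpret s: field_automorphism s
    by unfold_locales
       (simp_all only: s_def freshmans_dream'[OF e(2,1)] power_mult_distrib power_one)
  have s_pow: "(s ^^ i) x = x ^ (q ^ i)" for i x
    unfolding s_def by (rule funpow_power)
  have period: "(s ^^ (2 * t)) x = x" for x
    using power_card_eq_self[of UNIV x] assms(4,5) by (simp add: s_pow)
  have bar_bar: "(s ^^ t) ((s ^^ t) x) = x" for x
    using period[of x] by (simp add: mult_2 funpow_add)
  \<comment> \<open>Since \<open>s ^^ (2 * t)\<close> is the identity, this inverts \<open>s\<close>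
    twice.\<close>
  define k where "k = (s ^^ (2 * t - 2)) h"
  have "Suc (Suc (2 * t - 2)) = 2 * t" using assms(3) by simp
  then have k2: "s (s k) = h"
    using period[of h] unfolding k_def by (metis comp_apply funpow.simps(2))
  have h_norm: "h * (s ^^ t) h = - 1"
    using assms(11) by (simp add: s_pow mult.commute)
  \<comment> \<open>\<open>Fqt\<close> is the fixed field of \<open>s ^^ t\<close>.\<close>
  have h_fix: "(s ^^ t) h \<noteq> h"
    using assms(3,10) subfield_eq_fixed_points[OF assms(8,9) one_less_power[OF q]]
    by (simp add: s_pow)
  have two: "(2 :: 'a) \<noteq> 0"
  proof
    assume "(2 :: 'a) = 0"
    then have "CHAR('a) dvd 2"
      using of_nat_eq_0_iff_char_dvd[of 2, where ?'a = 'a] by simp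
    then have "CHAR('a) = 2"
      using e(2) primes_dvd_imp_eq two_is_prime_nat by blast
    with e(1) assms(2) q show False by (cases e) auto
  qed
  interpret st: field_automorphism "s ^^ t" by (rule s.funpow)
  have comm: "(s ^^ t) (s x) = s ((s ^^ t) x)" for x
    by (simp add: funpow_swap1)
  have "s (s (k * (s ^^ t) k)) = s (s (- 1))"
    using h_norm by (simp add: s.hom k2 flip: comm)
  then have k_norm: "k * (s ^^ t) k = - 1"
    by (simp only: s.eq_iff)
  have k_fix: "(s ^^ t) k \<noteq> k"
    using h_fix comm k2 by metis
  interpret tw: twisted_automorphism s t k "s ^^ t"
    by unfold_locales (use two bar_bar k_norm k_fix assms(3) in auto)
  have h_nz: "h \<noteq> 0" using h_norm by force
  have "poly (psi q t h) x = tw.twisted_psi x" for x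
  proof -
    have s_x: "s x = x ^ (q ^ 1)" by (simp add: s_def)
    have tau_x: "tw.tau x = x ^ (q ^ (t - 1))"
      unfolding tw.tau_def by (rule s_pow)
    have s_bar: "s ((s ^^ t) y) = y ^ (q ^ (t + 1))" for y
      using s_pow[of "t + 1" y] by simp
    have tau_bar: "tw.tau ((s ^^ t) y) = y ^ (q ^ (2 * t - 1))" for y
    proof -
      have "(s ^^ ((t - 1) + t)) y = tw.tau ((s ^^ t) y)"
        unfolding tw.tau_def funpow_add comp_apply ..
      moreover have "(t - 1) + t = 2 * t - 1" using assms(3) by simp
      ultimately show ?thesis by (metis s_pow)
    qed
    have powi: "h powi (1 - int i) = h / h ^ i" for i
      using h_nz by (simp add: power_int_diff)
    show ?thesis
      by (simp only: psi_def tw.twisted_psi_def poly_add poly_diff poly_monom mult_1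
          k2 s_bar tau_bar s_x tau_x powi)
  qed
  moreover have "Fq = {x. s x = x}"
    using subfield_eq_fixed_points[OF assms(6,7) q] by (simp add: s_def)
  ultimately show "scattered Fq (psi q t h)"
    unfolding scattered_def using tw.twisted_psi_scattered by auto
qed

end
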